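(* Let $|N|\ge 2$, $x\in N$, $M:=N\setminus x$ and $r\in\mathbb{R}^{\mathcal{P}(M)}$. Let $m=T_{\ell\text{-mod}}(r)\in\mathbb{R}^{\mathcal{P}(N)}$ be the lower modular extension of $r$. (i) One has $m\in\mathcal{K}(N)$ if and only if $r\in\mathcal{K}(M)$. The independency model induced by $m$ is then determined as follows: given $\langle a,b|C\rangle\in\mathcal{E}(N)$, one has $a\perp b\mid C\ [m]$ if and only if one of the following holds: - $x\notin a\cup b\cup C$; - $x\in\{a,b\}$ and $r_\ell((a\cup b\cup C)\setminus x)=r_\ell(C)$; - $x\in C$ and $a\perp b\mid (C\setminus x)\ [r]$. (ii) The function $r$ is extreme in $\mathcal{K}(M)$ if and only if $m=T_{\ell\text{-mod}}(r)$ is extreme in $\mathcal{K}(N)$.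
   Context: $N$ is a finite set and $\mathcal{P}(N)$ is its power set; a singleton $\{a\}$ is written $a$. $\mathbb{R}^{\mathcal{P}(N)}$ is the space of functions $m:\mathcal{P}(N)\to\mathbb{R}$ with scalar product $\langle m,u\rangle=\sum_{A\subseteq N}m(A)u(A)$. A function $m$ is supermodular if $m(A)+m(B)\le m(A\cup B)+m(A\cap B)$ for all $A,B\subseteq N$; $\mathcal{K}(N)$ is the cone of supermodular functions. $\mathcal{E}(N)$ is the set of triplets $\langle a,b|C\rangle$ with $a,b\in N$ distinct and $C\subseteq N\setminus\{a,b\}$. For $m\in\mathbb{R}^{\mathcal{P}(N)}$, $a\perp b\mid C\ [m]$ means $m(a\cup b\cup C)+m(C)-m(a\cup C)-m(b\cup C)=0$; the independency model induced by $m\in\mathcal{K}(N)$ is the set of $\langle a,b|C\rangle\in\mathcal{E}(N)$ with $a\perp b\mid C\ [m]$. A face of a convex cone $K\subseteq\mathbb{R}^{\mathcal{P}(N)}$ is a set $\{m\in K: k=\langle m,v\rangle\}$, where $v\in\mathbb{R}^{\mathcal{P}(N)}$, $k\in\mathbb{R}$ satisfy $k\le\langle m,v\rangle$ for all $m\in K$. The non-empty faces of $\mathcal{K}(N)$ form a lattice under inclusion with least element the space of modular functions $\mathcal{K}(N)\cap(-\mathcal{K}(N))$. A function is extreme in $\mathcal{K}(N)$ if it belongs to $\mathcal{K}(N)$ and the smallest face of $\mathcal{K}(N)$ containing it is an atom of this lattice. The same definitions are used for other finite sets in place of $N$. For $r\in\mathbb{R}^{\mathcal{P}(M)}$ the lower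 standardization is $r_\ell(T)=r(T)-r(\emptyset)+\sum_{i\in T}[r(\emptyset)-r(i)]$ for $T\subseteq M$. For $\emptyset\ne M\subsetneq N$ the lower modular extension $T_{\ell\text{-mod}}:\mathbb{R}^{\mathcal{P}(M)}\to\mathbb{R}^{\mathcal{P}(N)}$ is defined, for $S\subseteq N$, by $[T_{\ell\text{-mod}}(r)](S)=r(S\cap M)$ if $N\setminus M\subseteq S$, and $[T_{\ell\text{-mod}}(r)](S)=r(S\cap M)-r_\ell(S\cap M)$ otherwise. *)

theory Defs
  imports Complex_Main "HOL-Library.FuncSet"
begin

(* The space R^P(N) is the set of total functions that take the value "undefined" outside Pow N,
   so that equality of elements (hence of faces) only depends on the values on Pow N. *)
definition set_functions :: "'a set \<Rightarrow> ('a set \<Rightarrow> real) set" where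
  "set_functions N = Pow N \<rightarrow>\<^sub>E UNIV"

definition scalar_product :: "'a set \<Rightarrow> ('a set \<Rightarrow> real) \<Rightarrow> ('a set \<Rightarrow> real) \<Rightarrow> real" where
  "scalar_product N m u = (\<Sum>A\<in>Pow N. m A * u A)"

definition supermodular_cone :: "'a set \<Rightarrow> ('a set \<Rightarrow> real) set" where
  "supermodular_cone N =
     {m \<in> set_functions N. \<forall>A\<in>Pow N. \<forall>B\<in>Pow N. m A + m B \<le> m (A \<union> B) + m (A \<inter> B)}"

(* K(N) \<inter> (-K(N)); the negative is restricted to Pow N in order to stay in R^P(N). *)
definition modular_functions :: "'a set \<Rightarrow> ('a set \<Rightarrow> real) set" where
  "modular_functions N =
     supermodular_cone N \<inter> (\<lambda>m. \<lambda>S\<in>Pow N. - m S) ` supermodular_cone N"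

definition triplets :: "'a set \<Rightarrow> ('a \<times> 'a \<times> 'a set) set" where
  "triplets N = {(a, b, C). a \<in> N \<and> b \<in> N \<and> a \<noteq> b \<and> C \<subseteq> N - {a, b}}"

definition cond_indep :: "('a set \<Rightarrow> real) \<Rightarrow> 'a \<Rightarrow> 'a \<Rightarrow> 'a set \<Rightarrow> bool" where
  "cond_indep m a b C \<longleftrightarrow>
     m ({a} \<union> {b} \<union> C) + m C - m ({a} \<union> C) - m ({b} \<union> C) = 0"

definition indep_model :: "'a set \<Rightarrow> ('a set \<Rightarrow> real) \<Rightarrow> ('a \<times> 'a \<times> 'a set) set" where
  "indep_model N m = {(a, b, C). (a, b, C) \<in> triplets N \<and> cond_indep m a b C}"

definition is_face :: "'a set \<Rightarrow> ('a set \<Rightarrow> real) set \<Rightarrow> ('a set \<Rightarrow> real) set \<Rightarrow> bool" where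
  "is_face N K F \<longleftrightarrow>
     (\<exists>v\<in>set_functions N. \<exists>k::real.
        (\<forall>m\<in>K. k \<le> scalar_product N m v) \<and> F = {m \<in> K. k = scalar_product N m v})"

definition face_lattice :: "'a set \<Rightarrow> ('a set \<Rightarrow> real) set set" where
  "face_lattice N = {F. is_face N (supermodular_cone N) F \<and> F \<noteq> {}}"

definition is_smallest_face :: "'a set \<Rightarrow> ('a set \<Rightarrow> real) \<Rightarrow> ('a set \<Rightarrow> real) set \<Rightarrow> bool" where
  "is_smallest_face N m F \<longleftrightarrow>
     F \<in> face_lattice N \<and> m \<in> F \<and> (\<forall>G\<in>face_lattice N. m \<in> G \<longrightarrow> F \<subseteq> G)"

(* The least element of the face lattice is modular_functions N. *)
definition is_face_atom :: "'a set \<Rightarrow> ('a set \<Rightarrow> real) set \<Rightarrow> bool" where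
  "is_face_atom N F \<longleftrightarrow>
     F \<in> face_lattice N \<and> F \<noteq> modular_functions N \<and>
     (\<forall>G\<in>face_lattice N. G \<subseteq> F \<longrightarrow> G = modular_functions N \<or> G = F)"

definition is_extreme :: "'a set \<Rightarrow> ('a set \<Rightarrow> real) \<Rightarrow> bool" where
  "is_extreme N m \<longleftrightarrow>
     m \<in> supermodular_cone N \<and> (\<exists>F. is_smallest_face N m F \<and> is_face_atom N F)"

definition lower_std :: "'a set \<Rightarrow> ('a set \<Rightarrow> real) \<Rightarrow> 'a set \<Rightarrow> real" where
  "lower_std M r = (\<lambda>T\<in>Pow M. r T - r {} + (\<Sum>i\<in>T. r {} - r {i}))"

definition lower_modular_ext :: "'a set \<Rightarrow> 'a set \<Rightarrow> ('a set \<Rightarrow> real) \<Rightarrow> 'a set \<Rightarrow> real" where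
  "lower_modular_ext M N r =
     (\<lambda>S\<in>Pow N. if N - M \<subseteq> S then r (S \<inter> M) else r (S \<inter> M) - lower_std M r (S \<inter> M))"

end

(* The cone of supermodular functions is cut out by finitely many inequalities, so the smallest
   face containing m consists of the supermodular functions at which every inequality tight for m
   is tight.  Hence m is extreme iff it is supermodular, not modular, and any supermodular u with
   at least the tight inequalities of m is either modular or has exactly those of m.

   The inequalities of the lower modular extension m of r are those of r (both sets contain x),
   equalities (neither set contains x), and the monotonicity of the lower standardization of r
   (one set contains x).  The last are sums of inequalities of r, so the tight inequalities of m
   and of r determine each other.  Conversely, a supermodular function u with at least the tight
   inequalities of m agrees with the extension of its link T \<mapsto> u (T \<union> x) up to a
   multiple of the modular function S \<mapsto> [x \<notin> S]. *)
theory Submission imports Defs begin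

section \<open>Tight inequalities and faces\<close>

text \<open>The slack of the supermodular inequality at a pair of sets. It is linear in
  \<open>f\<close>, which is what lets sums of slacks serve as scalar products.\<close>

definition excess :: "('a set \<Rightarrow> real) \<Rightarrow> 'a set \<Rightarrow> 'a set \<Rightarrow> real" where
  "excess f A B = f (A \<union> B) + f (A \<inter> B) - f A - f B"

definition tight :: "'a set \<Rightarrow> ('a set \<Rightarrow> real) \<Rightarrow> ('a set \<times> 'a set) set" where
  "tight N f = {(A, B). A \<subseteq> N \<and> B \<subseteq> N \<and> excess f A B = 0}"

text \<open>The candidate for the smallest face containing \<open>m\<close>;
  \<open>is_smallest_face_iff\<close> confirms it.\<close>

definition tight_face :: "'a set \<Rightarrow> ('a set \<Rightarrow> real) \<Rightarrow> ('a set \<Rightarrow> real) set" where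
  "tight_face N m = {u \<in> supermodular_cone N. tight N m \<subseteq> tight N u}"

lemma excess_commute: "excess f A B = excess f B A"
  by (simp add: excess_def Un_commute Int_commute)

text \<open>Elements of \<open>set_functions N\<close> carry meaning on subsets of \<open>N\<close>
  only. This exchanges a restricted function for its unrestricted formula, on which linearity can be
  computed.\<close>

lemma excess_cong:
  assumes "\<And>S. S \<subseteq> N \<Longrightarrow> f S = g S" "A \<subseteq> N" "B \<subseteq> N"
  shows "excess f A B = excess g A B"
proof -
  have "A \<union> B \<subseteq> N" "A \<inter> B \<subseteq> N" using assms by auto
  then show ?thesis using assms by (simp add: excess_def)
qed

lemma tight_subset: "tight N f \<subseteq> Pow N \<times> Pow N"
  by (auto simp: tight_def)

lemma tight_transfer:
  assumes "tight N f \<subseteq> tight N g" "A \<subseteq> N" "B \<subseteq> N" "excess f A B = 0"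
  shows "excess g A B = 0"
proof -
  have "(A, B) \<in> tight N f" using assms by (simp add: tight_def)
  then have "(A, B) \<in> tight N g" using assms(1) by blast
  then show ?thesis by (simp add: tight_def)
qed

lemma supermodular_cone_iff:
  "m \<in> supermodular_cone N \<longleftrightarrow>
     m \<in> set_functions N \<and> (\<forall>A B. A \<subseteq> N \<longrightarrow> B \<subseteq> N \<longrightarrow> 0 \<le> excess m A B)"
proof -
  have "m A + m B \<le> m (A \<union> B) + m (A \<inter> B) \<longleftrightarrow> 0 \<le> excess m A B" for A B
    by (auto simp: excess_def)
  then show ?thesis by (auto simp: supermodular_cone_def)
qed

lemma supermodular_coneI:
  assumes "m \<in> set_functions N" "\<And>A B. A \<subseteq> N \<Longrightarrow> B \<subseteq> N \<Longrightarrow> 0 \<le> excess m A B"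
  shows "m \<in> supermodular_cone N"
  using assms by (simp add: supermodular_cone_iff)

lemma excess_nonneg:
  assumes "m \<in> supermodular_cone N" "A \<subseteq> N" "B \<subseteq> N"
  shows "0 \<le> excess m A B"
  using assms by (simp add: supermodular_cone_iff)

text \<open>Negation flips the sign of every excess, so \<open>m\<close> and its negative are both
  supermodular exactly when all excesses of \<open>m\<close> vanish.\<close>

lemma modular_functions_eq:
  "modular_functions N = {m \<in> supermodular_cone N. tight N m = Pow N \<times> Pow N}"
proof (intro set_eqI iffI)
  fix m assume "m \<in> modular_functions N"
  then obtain u where m: "m \<in> supermodular_cone N" and u: "u \<in> supermodular_cone N"
    and mu: "m = (\<lambda>S\<in>Pow N. - u S)" by (auto simp: modular_functions_def)
  have "excess m A B = 0" if AB: "A \<subseteq> N" "B \<subseteq> N" for A B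
  proof -
    have "excess m A B = excess (\<lambda>S. - u S) A B"
      by (rule excess_cong[OF _ AB]) (simp add: mu)
    moreover have "\<dots> = - excess u A B" by (simp add: excess_def)
    ultimately show ?thesis using excess_nonneg[OF m AB] excess_nonneg[OF u AB] by linarith
  qed
  then show "m \<in> {m \<in> supermodular_cone N. tight N m = Pow N \<times> Pow N}"
    using m by (auto simp: tight_def)
next
  fix m assume "m \<in> {m \<in> supermodular_cone N. tight N m = Pow N \<times> Pow N}"
  then have m: "m \<in> supermodular_cone N" and t: "tight N m = Pow N \<times> Pow N" by auto
  let ?u = "\<lambda>S\<in>Pow N. - m S"
  have "?u \<in> supermodular_cone N"
  proof (rule supermodular_coneI)
    show "?u \<in> set_functions N" by (simp add: set_functions_def)
    fix A B assume AB: "A \<subseteq> N" "B \<subseteq> N"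
    have "excess ?u A B = excess (\<lambda>S. - m S) A B"
      by (rule excess_cong[OF _ AB]) simp
    moreover have "\<dots> = - excess m A B" by (simp add: excess_def)
    moreover have "excess m A B = 0" using t AB by (auto simp: tight_def)
    ultimately show "0 \<le> excess ?u A B" by linarith
  qed
  \<comment> \<open>The double negation returns \<open>m\<close> itself because \<open>m\<close>
    already takes the default value outside \<open>Pow N\<close>.\<close>
  moreover have "m = (\<lambda>S\<in>Pow N. - ?u S)"
    using m by (auto simp: supermodular_cone_def set_functions_def fun_eq_iff PiE_def
        extensional_def restrict_def)
  ultimately show "m \<in> modular_functions N"
    using m unfolding modular_functions_def by (intro IntI image_eqI)
qed

text \<open>The exposing functional is the sum of the excesses over all tight pairs of
  \<open>m\<close>. Each summand is nonnegative on the cone, so the sum is zero exactly when every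
  summand is.\<close>

lemma tight_face_is_face:
  assumes fin: "finite N"
  shows "is_face N (supermodular_cone N) (tight_face N m)"
proof -
  let ?P = "tight N m"
  have P: "?P \<subseteq> Pow N \<times> Pow N" by (rule tight_subset)
  have finP: "finite ?P" using P by (rule finite_subset) (simp add: fin)
  \<comment> \<open>The coefficient at \<open>S\<close> is the value of that functional on the
    indicator function of the single set \<open>S\<close>; linearity then gives
    \<open>sp\<close>.\<close>
  define v where "v = (\<lambda>S\<in>Pow N. \<Sum>(A, B)\<in>?P. excess (\<lambda>T. of_bool (S = T)) A B)"
  have sp: "scalar_product N u v = (\<Sum>(A, B)\<in>?P. excess u A B)" for u
  proof -
    have one: "(\<Sum>S\<in>Pow N. u S * of_bool (S = T)) = u T" if "T \<subseteq> N" for T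
    proof -
      have "(\<Sum>S\<in>Pow N. u S * of_bool (S = T)) = (\<Sum>S\<in>Pow N. if S = T then u S else 0)"
        by (rule sum.cong) auto
      also have "\<dots> = u T" using that fin by (simp add: sum.delta)
      finally show ?thesis .
    qed
    have "scalar_product N u v =
        (\<Sum>S\<in>Pow N. \<Sum>p\<in>?P. u S * excess (\<lambda>T. of_bool (S = T)) (fst p) (snd p))"
      unfolding scalar_product_def v_def
      by (rule sum.cong) (auto simp: sum_distrib_left case_prod_beta)
    also have "\<dots> = (\<Sum>p\<in>?P. \<Sum>S\<in>Pow N. u S * excess (\<lambda>T. of_bool (S = T)) (fst p) (snd p))"
      by (rule sum.swap)
    also have "\<dots> = (\<Sum>p\<in>?P. excess u (fst p) (snd p))"
    proof (rule sum.cong[OF refl])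
      fix p assume "p \<in> ?P"
      then have "fst p \<subseteq> N" "snd p \<subseteq> N" by (auto simp: tight_def)
      then have *: "fst p \<union> snd p \<subseteq> N" "fst p \<inter> snd p \<subseteq> N" "fst p \<subseteq> N" "snd p \<subseteq> N"
        by auto
      show "(\<Sum>S\<in>Pow N. u S * excess (\<lambda>T. of_bool (S = T)) (fst p) (snd p))
          = excess u (fst p) (snd p)"
        unfolding excess_def right_diff_distrib distrib_left sum.distrib sum_subtractf
        by (simp only: one * excess_def)
    qed
    finally show ?thesis by (simp add: case_prod_beta)
  qed
  have nonneg: "0 \<le> excess u (fst p) (snd p)" if "u \<in> supermodular_cone N" "p \<in> ?P" for u p
    using that by (auto intro: excess_nonneg simp: tight_def)
  show ?thesis unfolding is_face_def
  proof (intro bexI exI conjI ballI)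
    show "v \<in> set_functions N" by (simp add: v_def set_functions_def)
    show "0 \<le> scalar_product N u v" if "u \<in> supermodular_cone N" for u
      unfolding sp using nonneg[OF that] by (auto intro!: sum_nonneg simp: case_prod_beta)
    have "(0 = scalar_product N u v) = (?P \<subseteq> tight N u)" if u: "u \<in> supermodular_cone N" for u
    proof -
      have "(0 = scalar_product N u v) = (\<forall>p\<in>?P. excess u (fst p) (snd p) = 0)"
        unfolding sp case_prod_beta
        using sum_nonneg_eq_0_iff[OF finP nonneg[OF u]] by auto
      also have "\<dots> = (?P \<subseteq> tight N u)"
        by (auto simp: tight_def intro: tight_transfer[unfolded tight_def])
      finally show ?thesis .
    qed
    then show "tight_face N m = {u \<in> supermodular_cone N. 0 = scalar_product N u v}"
      by (auto simp: tight_face_def)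
  qed
qed

text \<open>Each \<open>p\<close> with \<open>g p > 0\<close> allows the factor
  \<open>f p / g p\<close>, which is positive, and any factor works when \<open>g p = 0\<close>.
  Over a finite set the minimum of such factors stays positive.\<close>

lemma common_scaling_below:
  fixes f g :: "'b \<Rightarrow> real"
  assumes "finite P" "\<And>p. p \<in> P \<Longrightarrow> 0 \<le> f p" "\<And>p. p \<in> P \<Longrightarrow> 0 \<le> g p"
    and "\<And>p. p \<in> P \<Longrightarrow> f p = 0 \<Longrightarrow> g p = 0"
  shows "\<exists>t>0. \<forall>p\<in>P. t * g p \<le> f p"
  using assms
proof (induction P)
  case empty
  show ?case by (rule exI[of _ 1]) simp
next
  case (insert q P)
  from insert.IH insert.prems obtain t where t: "t > 0" "\<forall>p\<in>P. t * g p \<le> f p" by auto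
  obtain s where s: "s > 0" "s * g q \<le> f q"
  proof (cases "g q = 0")
    case True
    then show ?thesis using that[of 1] insert.prems by auto
  next
    case False
    then have "g q > 0" "f q > 0" using insert.prems by (auto simp: order_less_le)
    then show ?thesis using that[of "f q / g q"] by simp
  qed
  have "min s t * g p \<le> f p" if "p \<in> insert q P" for p
  proof (cases "p = q")
    case True
    have "min s t * g q \<le> s * g q" using insert.prems by (intro mult_right_mono) auto
    with s True show ?thesis by auto
  next
    case False
    have "min s t * g p \<le> t * g p" using insert.prems that by (intro mult_right_mono) auto
    with t False that show ?thesis by fastforce
  qed
  then show ?case using s t by (intro exI[of _ "min s t"]) auto
qed

text \<open>A member u of the tight face of m can be slightly overshot from m inside the cone, in the
  direction m - u, so a linear functional minimal at m is constant on that face.\<close>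
lemma tight_face_subset_face:
  assumes fin: "finite N" and G: "is_face N (supermodular_cone N) G" and mG: "m \<in> G"
  shows "tight_face N m \<subseteq> G"
proof
  fix u assume "u \<in> tight_face N m"
  then have u: "u \<in> supermodular_cone N" and tu: "tight N m \<subseteq> tight N u"
    by (auto simp: tight_face_def)
  from G obtain v k where kv: "\<And>w. w \<in> supermodular_cone N \<Longrightarrow> k \<le> scalar_product N w v"
    and Gv: "G = {w \<in> supermodular_cone N. k = scalar_product N w v}"
    unfolding is_face_def by blast
  have m: "m \<in> supermodular_cone N" and km: "k = scalar_product N m v" using mG Gv by auto
  have "\<exists>t>0. \<forall>p\<in>Pow N \<times> Pow N. t * excess u (fst p) (snd p) \<le> excess m (fst p) (snd p)"
    using fin m u tu
    by (intro common_scaling_below) (auto intro: excess_nonneg tight_transfer[OF tu])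
  then obtain t where t: "t > 0"
    and tle: "\<And>A B. A \<subseteq> N \<Longrightarrow> B \<subseteq> N \<Longrightarrow> t * excess u A B \<le> excess m A B" by fastforce
  define w where "w = (\<lambda>S\<in>Pow N. (1 + t) * m S - t * u S)"
  have "w \<in> supermodular_cone N"
  proof (rule supermodular_coneI)
    show "w \<in> set_functions N" by (simp add: w_def set_functions_def)
    fix A B assume AB: "A \<subseteq> N" "B \<subseteq> N"
    have "excess w A B = excess (\<lambda>S. (1 + t) * m S - t * u S) A B"
      by (rule excess_cong[OF _ AB]) (simp add: w_def)
    also have "\<dots> = (1 + t) * excess m A B - t * excess u A B"
      by (simp add: excess_def algebra_simps)
    finally have e: "excess w A B = excess m A B + t * excess m A B - t * excess u A B"
      by (simp add: algebra_simps)
    have "0 \<le> t * excess m A B" using t excess_nonneg[OF m AB] by simp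
    with e tle[OF AB] show "0 \<le> excess w A B" by linarith
  qed
  then have "k \<le> scalar_product N w v" by (rule kv)
  also have "\<dots> = (1 + t) * scalar_product N m v - t * scalar_product N u v"
    unfolding scalar_product_def sum_distrib_left sum_subtractf[symmetric]
    by (rule sum.cong) (auto simp: w_def algebra_simps)
  \<comment> \<open>The bound at \<open>w\<close>, together with the value \<open>k\<close> at
    \<open>m\<close>, bounds the value at \<open>u\<close> from above; \<open>kv[OF u]\<close> is
    the opposite bound.\<close>
  finally have "t * scalar_product N u v \<le> t * k" using km by (simp add: algebra_simps)
  then have "scalar_product N u v \<le> k" using t by simp
  with kv[OF u] u Gv show "u \<in> G" by auto
qed

section \<open>Smallest faces and extremality\<close>

lemma is_smallest_face_iff:
  assumes fin: "finite N" and m: "m \<in> supermodular_cone N"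
  shows "is_smallest_face N m F \<longleftrightarrow> F = tight_face N m"
proof -
  have "m \<in> tight_face N m" using m by (simp add: tight_face_def)
  then have 1: "is_smallest_face N m (tight_face N m)"
    using tight_face_is_face[OF fin] tight_face_subset_face[OF fin]
    by (auto simp: is_smallest_face_def face_lattice_def)
  then show ?thesis by (auto simp: is_smallest_face_def)
qed

text \<open>Passing from \<open>u\<close> to \<open>tight_face N u\<close> reverses inclusion of
  tight sets, and the modular functions form the tight face with all pairs tight. Being an atom thus
  becomes a maximality condition on tight sets, free of faces.\<close>

lemma is_extreme_iff:
  assumes fin: "finite N"
  shows "is_extreme N m \<longleftrightarrow>
    m \<in> supermodular_cone N \<and> tight N m \<noteq> Pow N \<times> Pow N \<and>
    (\<forall>u\<in>supermodular_cone N. tight N m \<subseteq> tight N u \<longrightarrow>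
       tight N u = Pow N \<times> Pow N \<or> tight N u = tight N m)"
    (is "?L \<longleftrightarrow> ?c \<and> ?n \<and> ?e")
proof (cases "m \<in> supermodular_cone N")
  case False
  then show ?thesis by (simp add: is_extreme_def)
next
  case m: True
  have ext: "?L \<longleftrightarrow> is_face_atom N (tight_face N m)"
    using is_smallest_face_iff[OF fin m] m by (auto simp: is_extreme_def)
  have self: "u \<in> tight_face N u" if "u \<in> supermodular_cone N" for u
    using that by (simp add: tight_face_def)
  have lat: "tight_face N u \<in> face_lattice N" if "u \<in> supermodular_cone N" for u
    using tight_face_is_face[OF fin] self[OF that] by (auto simp: face_lattice_def)
  have eqmod: "tight_face N u = modular_functions N \<longleftrightarrow> tight N u = Pow N \<times> Pow N"
    if "u \<in> supermodular_cone N" for u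
  proof
    assume "tight_face N u = modular_functions N"
    then show "tight N u = Pow N \<times> Pow N" using self[OF that] by (simp add: modular_functions_eq)
  next
    assume "tight N u = Pow N \<times> Pow N"
    then show "tight_face N u = modular_functions N"
      using tight_subset by (fastforce simp: tight_face_def modular_functions_eq)
  qed
  show ?thesis
  proof
    assume ?L
    then have atom: "is_face_atom N (tight_face N m)" using ext by simp
    have ?e
    proof (intro ballI impI)
      fix u assume u: "u \<in> supermodular_cone N" and "tight N m \<subseteq> tight N u"
      then have "tight_face N u \<subseteq> tight_face N m" by (auto simp: tight_face_def)
      then have "tight_face N u = modular_functions N \<or> tight_face N u = tight_face N m"
        using atom lat[OF u] by (auto simp: is_face_atom_def)
      then show "tight N u = Pow N \<times> Pow N \<or> tight N u = tight N m"
      proof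
        assume "tight_face N u = tight_face N m"
        then have "u \<in> tight_face N m" "m \<in> tight_face N u" using self[OF u] self[OF m] by auto
        then show ?thesis by (auto simp: tight_face_def)
      qed (use eqmod[OF u] in simp)
    qed
    moreover have ?n using atom eqmod[OF m] by (simp add: is_face_atom_def)
    ultimately show "?c \<and> ?n \<and> ?e" using m by simp
  next
    assume R: "?c \<and> ?n \<and> ?e"
    have "G = modular_functions N \<or> G = tight_face N m"
      if G: "G \<in> face_lattice N" and sub: "G \<subseteq> tight_face N m" for G
    \<comment> \<open>A face contains the tight face of each of its members. A modular member yields
      all modular functions; a non-modular member has, by \<open>R\<close>, the tight pairs of
      \<open>m\<close> and yields the whole of \<open>tight_face N m\<close>.\<close>
    proof (cases "G \<subseteq> modular_functions N")
      case True
      obtain u where u: "u \<in> G" using G by (auto simp: face_lattice_def)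
      have uc: "u \<in> supermodular_cone N" and "tight N u = Pow N \<times> Pow N"
        using subsetD[OF True u] by (simp_all add: modular_functions_eq)
      then have "modular_functions N = tight_face N u" using eqmod[OF uc] by simp
      also have "\<dots> \<subseteq> G"
        using G u by (intro tight_face_subset_face[OF fin]) (auto simp: face_lattice_def)
      finally show ?thesis using True by simp
    next
      case False
      then obtain u where u: "u \<in> G" "u \<notin> modular_functions N" by auto
      have "u \<in> tight_face N m" using sub u(1) by blast
      then have "u \<in> supermodular_cone N" "tight N m \<subseteq> tight N u"
        by (simp_all add: tight_face_def)
      moreover from this(1) u(2) have "tight N u \<noteq> Pow N \<times> Pow N"
        by (simp add: modular_functions_eq)
      ultimately have "tight N u = tight N m" using R by blast
      then have "tight_face N m = tight_face N u" by (simp add: tight_face_def)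
      also have "\<dots> \<subseteq> G"
        using G u by (intro tight_face_subset_face[OF fin]) (auto simp: face_lattice_def)
      finally show ?thesis using sub by simp
    qed
    then show ?L using ext lat[OF m] eqmod[OF m] R by (auto simp: is_face_atom_def)
  qed
qed

section \<open>Lower standardization\<close>

lemma lower_std_empty: "lower_std M r {} = 0"
  by (simp add: lower_std_def)

lemma lower_std_singleton: "a \<in> M \<Longrightarrow> lower_std M r {a} = 0"
  by (simp add: lower_std_def)

text \<open>The lower standardization differs from \<open>r\<close> by a constant and a sum over
  elements, and such a modular term has zero excess.\<close>

lemma excess_lower_std:
  assumes "finite M" "A \<subseteq> M" "B \<subseteq> M"
  shows "excess (lower_std M r) A B = excess r A B"
proof -
  let ?s = "\<lambda>T. \<Sum>i\<in>T. r {} - r {i}"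
  have fin: "finite A" "finite B" using assms finite_subset by auto
  have "excess (lower_std M r) A B = excess (\<lambda>T. r T - r {} + ?s T) A B"
    using assms(2,3) by (intro excess_cong[of M]) (auto simp: lower_std_def)
  also have "\<dots> = excess r A B + (?s (A \<union> B) + ?s (A \<inter> B) - ?s A - ?s B)"
    unfolding excess_def by (simp add: algebra_simps)
  also have "?s (A \<union> B) + ?s (A \<inter> B) = ?s A + ?s B" using fin by (rule sum.union_inter)
  finally show ?thesis by simp
qed

text \<open>Since the standardization vanishes at the empty set and at singletons, its increment on
  adding one element is an excess.\<close>

lemma lower_std_insert:
  assumes "finite M" "T \<subseteq> M" "a \<in> M" "a \<notin> T"
  shows "lower_std M r (insert a T) = lower_std M r T + excess r T {a}"
proof -
  have "excess r T {a} = excess (lower_std M r) T {a}" using assms by (simp add: excess_lower_std)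
  then show ?thesis using assms by (simp add: excess_def lower_std_empty lower_std_singleton)
qed

text \<open>The elements of \<open>B\<close> are added to \<open>A\<close> one at a time; each
  increment is an excess of \<open>r\<close>, hence nonnegative.\<close>

lemma lower_std_mono:
  assumes "finite M" "r \<in> supermodular_cone M" "A \<subseteq> B" "B \<subseteq> M"
  shows "lower_std M r A \<le> lower_std M r B"
proof -
  have "lower_std M r A \<le> lower_std M r (A \<union> D)" if "finite D" "D \<subseteq> M" for D
    using that
  proof (induction D)
    case (insert d D)
    show ?case
    proof (cases "d \<in> A \<union> D")
      case True
      then have "A \<union> insert d D = A \<union> D" by auto
      then show ?thesis using insert by simp
    next
      case False
      have "0 \<le> excess r (A \<union> D) {d}"
        using assms insert.prems by (intro excess_nonneg) auto
      then show ?thesis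
        using lower_std_insert[of M "A \<union> D" d r] False insert assms by auto
    qed
  qed simp
  from this[of B] have "lower_std M r A \<le> lower_std M r (A \<union> B)"
    using assms finite_subset by auto
  then show ?thesis using assms(3) by (simp add: Un_absorb1)
qed

text \<open>The same chain from \<open>A\<close> to \<open>B\<close> with zero total increment:
  every single increment of \<open>r\<close> is a vanishing excess, so the matching excess of
  \<open>r'\<close> vanishes too.\<close>

lemma lower_std_eq_transfer:
  assumes "finite M" "r \<in> supermodular_cone M" "tight M r \<subseteq> tight M r'"
    and "A \<subseteq> B" "B \<subseteq> M" "lower_std M r A = lower_std M r B"
  shows "lower_std M r' A = lower_std M r' B"
proof -
  have "lower_std M r' A = lower_std M r' (A \<union> D)"
    if "finite D" "D \<subseteq> M" "lower_std M r A = lower_std M r (A \<union> D)" for D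
    using that
  proof (induction D)
    case (insert d D)
    show ?case
    proof (cases "d \<in> A \<union> D")
      case True
      then have "A \<union> insert d D = A \<union> D" by auto
      then show ?thesis using insert by simp
    next
      case False
      have sub: "A \<union> D \<subseteq> M" "d \<in> M" using assms insert.prems by auto
      have step: "lower_std M f (insert d (A \<union> D)) = lower_std M f (A \<union> D) + excess f (A \<union> D) {d}"
        for f using lower_std_insert[of M "A \<union> D" d] False sub assms by auto
      have "0 \<le> excess r (A \<union> D) {d}" using assms sub by (intro excess_nonneg) auto
      moreover have "lower_std M r A \<le> lower_std M r (A \<union> D)"
        using assms sub by (intro lower_std_mono) auto
      \<comment> \<open>Two nonnegative increments, from \<open>A\<close> to
        \<open>A \<union> D\<close> and on to \<open>d\<close>, add up to zero, so both
        vanish.\<close>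
      ultimately have "excess r (A \<union> D) {d} = 0"
        and IH: "lower_std M r A = lower_std M r (A \<union> D)"
        using step[of r] insert.prems by auto
      then have "excess r' (A \<union> D) {d} = 0"
        using sub by (intro tight_transfer[OF assms(3)]) auto
      then show ?thesis using step[of r'] insert.IH[OF _ IH] insert.prems by auto
    qed
  qed simp
  from this[of B] show ?thesis
    using assms finite_subset[of B M] by (simp add: Un_absorb1)
qed

section \<open>Lower modular extension by one element\<close>

context
  fixes N M :: "'a set" and x :: 'a
  assumes fin: "finite N" and xN: "x \<in> N" and M_eq: "M = N - {x}"
begin

lemma finite_M: "finite M"
  using fin M_eq by simp

lemma lower_modular_ext_mem:
  assumes "S \<subseteq> N" "x \<in> S"
  shows "lower_modular_ext M N r S = r (S - {x})"
proof -
  have "N - M = {x}" "S \<inter> M = S - {x}" using assms xN M_eq by auto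
  then show ?thesis using assms by (simp add: lower_modular_ext_def)
qed

lemma lower_modular_ext_not_mem:
  assumes "S \<subseteq> N" "x \<notin> S"
  shows "lower_modular_ext M N r S = r S - lower_std M r S"
proof -
  have "N - M = {x}" "S \<inter> M = S" using assms xN M_eq by auto
  then show ?thesis using assms by (simp add: lower_modular_ext_def)
qed

lemma lower_modular_ext_set_functions: "lower_modular_ext M N r \<in> set_functions N"
  by (simp add: lower_modular_ext_def set_functions_def)

section \<open>Excesses of the extension\<close>

lemma excess_ext_mem_mem:
  assumes "A \<subseteq> N" "B \<subseteq> N" "x \<in> A" "x \<in> B"
  shows "excess (lower_modular_ext M N r) A B = excess r (A - {x}) (B - {x})"
proof -
  have "A \<union> B - {x} = (A - {x}) \<union> (B - {x})" "A \<inter> B - {x} = (A - {x}) \<inter> (B - {x})" by auto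
  moreover have "A \<union> B \<subseteq> N" "A \<inter> B \<subseteq> N" using assms by auto
  ultimately show ?thesis using assms by (simp add: excess_def lower_modular_ext_mem)
qed

text \<open>Away from \<open>x\<close> the extension is \<open>r\<close> minus its lower
  standardization, two functions with equal excesses.\<close>

lemma excess_ext_not_mem_not_mem:
  assumes "A \<subseteq> M" "B \<subseteq> M"
  shows "excess (lower_modular_ext M N r) A B = 0"
proof -
  have "A \<subseteq> N" "B \<subseteq> N" "A \<union> B \<subseteq> N" "A \<inter> B \<subseteq> N" "x \<notin> A" "x \<notin> B"
    using assms M_eq by auto
  then show ?thesis using excess_lower_std[OF finite_M assms, of r]
    by (simp add: excess_def lower_modular_ext_not_mem)
qed

text \<open>After the excess of \<open>r\<close> is replaced by that of its standardization, the
  standardized values at \<open>B\<close> and at the intersection cancel.\<close>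

lemma excess_ext_mem_not_mem:
  assumes "A \<subseteq> N" "B \<subseteq> M" "x \<in> A"
  shows "excess (lower_modular_ext M N r) A B =
    lower_std M r ((A - {x}) \<union> B) - lower_std M r (A - {x})"
proof -
  have AM: "A - {x} \<subseteq> M" using assms M_eq by auto
  have "A \<union> B - {x} = (A - {x}) \<union> B" "A \<inter> B = (A - {x}) \<inter> B"
    using assms M_eq by auto
  moreover have "B \<subseteq> N" "A \<union> B \<subseteq> N" "A \<inter> B \<subseteq> N" "x \<notin> B" "(A - {x}) \<inter> B \<subseteq> N"
    using assms M_eq by auto
  ultimately show ?thesis using assms excess_lower_std[OF finite_M AM assms(2), of r]
    by (simp add: excess_def lower_modular_ext_mem lower_modular_ext_not_mem)
qed

lemma subset_pair_cases:
  assumes "A \<subseteq> N" "B \<subseteq> N"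
  obtains (mem_mem) "x \<in> A" "x \<in> B" | (mem_not) "x \<in> A" "B \<subseteq> M"
    | (not_mem) "A \<subseteq> M" "x \<in> B" | (not_not) "A \<subseteq> M" "B \<subseteq> M"
  using assms M_eq by blast

text \<open>Every excess of \<open>r\<close> occurs among those of the extension; this carries
  properties of the extension back to \<open>r\<close>.\<close>

lemma excess_link:
  assumes "A \<subseteq> M" "B \<subseteq> M"
  shows "excess (lower_modular_ext M N r) (insert x A) (insert x B) = excess r A B"
proof -
  have "insert x A - {x} = A" "insert x B - {x} = B" "insert x A \<subseteq> N" "insert x B \<subseteq> N"
    using assms M_eq xN by auto
  then show ?thesis using excess_ext_mem_mem[of "insert x A" "insert x B" r] by simp
qed

lemma supermodular_ext_iff:
  assumes r: "r \<in> set_functions M"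
  shows "lower_modular_ext M N r \<in> supermodular_cone N \<longleftrightarrow> r \<in> supermodular_cone M"
proof
  assume m: "lower_modular_ext M N r \<in> supermodular_cone N"
  show "r \<in> supermodular_cone M"
  proof (rule supermodular_coneI[OF r])
    fix A B assume AB: "A \<subseteq> M" "B \<subseteq> M"
    then have "insert x A \<subseteq> N" "insert x B \<subseteq> N" using M_eq xN by auto
    then show "0 \<le> excess r A B" using excess_nonneg[OF m] excess_link[OF AB] by metis
  qed
next
  assume rs: "r \<in> supermodular_cone M"
  have mixed: "0 \<le> excess (lower_modular_ext M N r) A B" if "A \<subseteq> N" "B \<subseteq> M" "x \<in> A" for A B
  proof -
    have "lower_std M r (A - {x}) \<le> lower_std M r ((A - {x}) \<union> B)"
      using that M_eq by (intro lower_std_mono[OF finite_M rs]) auto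
    then show ?thesis using excess_ext_mem_not_mem[OF that] by simp
  qed
  show "lower_modular_ext M N r \<in> supermodular_cone N"
  proof (rule supermodular_coneI[OF lower_modular_ext_set_functions])
    fix A B assume AB: "A \<subseteq> N" "B \<subseteq> N"
    then show "0 \<le> excess (lower_modular_ext M N r) A B"
    proof (cases rule: subset_pair_cases)
      case mem_mem
      have "A - {x} \<subseteq> M" "B - {x} \<subseteq> M" using AB M_eq by auto
      then show ?thesis using excess_ext_mem_mem[OF AB mem_mem] excess_nonneg[OF rs] by simp
    next
      case mem_not
      then show ?thesis using mixed AB by simp
    next
      case not_mem
      then show ?thesis using mixed[of B A] AB by (simp add: excess_commute)
    next
      case not_not
      then show ?thesis using excess_ext_not_mem_not_mem by simp
    qed
  qed
qed

section \<open>Tight pairs of a function and of its extension\<close>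

text \<open>Pairs on the same side of \<open>x\<close> are direct. For a mixed pair, tightness is an
  equality of two standardized values, which \<open>lower_std_eq_transfer\<close> passes from
  \<open>r\<close> to \<open>r'\<close>.\<close>

lemma tight_ext_mono:
  assumes rs: "r \<in> supermodular_cone M" and sub: "tight M r \<subseteq> tight M r'"
  shows "tight N (lower_modular_ext M N r) \<subseteq> tight N (lower_modular_ext M N r')"
proof -
  have mixed: "excess (lower_modular_ext M N r') A B = 0"
    if AB: "A \<subseteq> N" "B \<subseteq> M" "x \<in> A" and e: "excess (lower_modular_ext M N r) A B = 0" for A B
  proof -
    have "lower_std M r (A - {x}) = lower_std M r ((A - {x}) \<union> B)"
      using e excess_ext_mem_not_mem[OF AB, of r] by simp
    then have "lower_std M r' (A - {x}) = lower_std M r' ((A - {x}) \<union> B)"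
      using AB M_eq by (intro lower_std_eq_transfer[OF finite_M rs sub]) auto
    then show ?thesis using excess_ext_mem_not_mem[OF AB] by simp
  qed
  have "excess (lower_modular_ext M N r') A B = 0"
    if AB: "A \<subseteq> N" "B \<subseteq> N" and e: "excess (lower_modular_ext M N r) A B = 0" for A B
    using AB
  proof (cases rule: subset_pair_cases)
    case mem_mem
    have "A - {x} \<subseteq> M" "B - {x} \<subseteq> M" using AB M_eq by auto
    then have "excess r' (A - {x}) (B - {x}) = 0"
      using e excess_ext_mem_mem[OF AB mem_mem, of r] by (intro tight_transfer[OF sub]) simp_all
    then show ?thesis using excess_ext_mem_mem[OF AB mem_mem] by simp
  next
    case mem_not
    then show ?thesis using mixed AB e by simp
  next
    case not_mem
    then show ?thesis using mixed[of B A] AB e by (simp add: excess_commute)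
  next
    case not_not
    then show ?thesis using excess_ext_not_mem_not_mem by simp
  qed
  then show ?thesis by (auto simp: tight_def)
qed

lemma tight_ext_top_iff:
  assumes rs: "r \<in> supermodular_cone M"
  shows "tight N (lower_modular_ext M N r) = Pow N \<times> Pow N \<longleftrightarrow> tight M r = Pow M \<times> Pow M"
proof
  assume t: "tight N (lower_modular_ext M N r) = Pow N \<times> Pow N"
  have "excess r A B = 0" if AB: "A \<subseteq> M" "B \<subseteq> M" for A B
  proof -
    have "(insert x A, insert x B) \<in> Pow N \<times> Pow N" using AB M_eq xN by auto
    then have "excess (lower_modular_ext M N r) (insert x A) (insert x B) = 0"
      unfolding t[symmetric] by (simp add: tight_def)
    then show ?thesis using excess_link[OF AB] by simp
  qed
  then show "tight M r = Pow M \<times> Pow M" by (auto simp: tight_def)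
next
  assume t: "tight M r = Pow M \<times> Pow M"
  \<comment> \<open>The converse compares \<open>r\<close> with the zero function: its extension is
    zero on \<open>Pow N\<close>, hence has all pairs tight, and \<open>tight_ext_mono\<close> hands
    them on to the extension of \<open>r\<close>.\<close>
  define z :: "'a set \<Rightarrow> real" where "z = (\<lambda>S\<in>Pow M. 0)"
  have z0: "z S = 0" if "S \<subseteq> M" for S using that by (simp add: z_def)
  have ez: "excess z A B = 0" if "A \<subseteq> M" "B \<subseteq> M" for A B
    using excess_cong[OF z0 that] by (simp add: excess_def)
  have zs: "z \<in> supermodular_cone M"
    using ez by (intro supermodular_coneI) (auto simp: z_def set_functions_def)
  have lz: "lower_std M z S = 0" if "S \<subseteq> M" for S
    using that z0 by (auto simp: lower_std_def intro!: sum.neutral)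
  have mz: "lower_modular_ext M N z S = 0" if "S \<subseteq> N" for S
  proof -
    have "S - {x} \<subseteq> M" "x \<notin> S \<Longrightarrow> S \<subseteq> M" using that M_eq by auto
    then show ?thesis using that z0 lz
      by (cases "x \<in> S") (simp_all add: lower_modular_ext_mem lower_modular_ext_not_mem)
  qed
  have "excess (lower_modular_ext M N z) A B = 0" if "A \<subseteq> N" "B \<subseteq> N" for A B
    using excess_cong[OF mz that] by (simp add: excess_def)
  then have "Pow N \<times> Pow N \<subseteq> tight N (lower_modular_ext M N z)" by (auto simp: tight_def)
  also have "\<dots> \<subseteq> tight N (lower_modular_ext M N r)"
    using t by (intro tight_ext_mono[OF zs]) (auto simp: tight_def)
  finally show "tight N (lower_modular_ext M N r) = Pow N \<times> Pow N" by (auto simp: tight_def)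
qed

lemma tight_ext_antimono:
  assumes "tight N (lower_modular_ext M N r) \<subseteq> tight N (lower_modular_ext M N r')"
  shows "tight M r \<subseteq> tight M r'"
proof -
  have "excess r' A B = 0" if AB: "A \<subseteq> M" "B \<subseteq> M" and e: "excess r A B = 0" for A B
  proof -
    have "insert x A \<subseteq> N" "insert x B \<subseteq> N" using AB M_eq xN by auto
    then show ?thesis
      using e excess_link[OF AB] tight_transfer[OF assms, of "insert x A" "insert x B"] by simp
  qed
  then show ?thesis by (auto simp: tight_def)
qed

text \<open>A modular function is determined by its values at the empty set and at singletons; the
  sum is written in the shape occurring in \<open>lower_std\<close>.\<close>

lemma modular_expansion:
  assumes "finite S" "S \<subseteq> M" "\<And>A B. A \<subseteq> M \<Longrightarrow> B \<subseteq> M \<Longrightarrow> excess u A B = 0"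
  shows "u S = u {} - (\<Sum>i\<in>S. u {} - u {i})"
  using assms(1,2)
proof (induction S)
  case (insert a S)
  then have "excess u S {a} = 0" by (intro assms(3)) auto
  then show ?case using insert by (simp add: excess_def)
qed simp

text \<open>Two kinds of pairs are tight for every extension: those avoiding \<open>x\<close> make
  \<open>u\<close> modular on subsets of \<open>M\<close>, and the pairs \<open>{x}\<close>,
  \<open>{i}\<close> give \<open>u\<close> and its link \<open>w\<close> the same singleton
  increments. Hence the extension of \<open>w\<close> differs from \<open>u\<close> by a modular
  function.\<close>

lemma tight_eq_ext_link:
  assumes sub: "tight N (lower_modular_ext M N r) \<subseteq> tight N u"
  defines "w \<equiv> \<lambda>T\<in>Pow M. u (insert x T)"
  shows "tight N (lower_modular_ext M N w) = tight N u"
proof -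
  have modM: "excess u A B = 0" if AB: "A \<subseteq> M" "B \<subseteq> M" for A B
  proof -
    have "A \<subseteq> N" "B \<subseteq> N" using AB M_eq by auto
    then show ?thesis using tight_transfer[OF sub] excess_ext_not_mem_not_mem[OF AB] by blast
  qed
  have pair: "u {} - u {i} = u {x} - u {x, i}" if i: "i \<in> M" for i
  proof -
    have ix: "i \<noteq> x" "{x} \<subseteq> N" "{i} \<subseteq> M" "{i} \<subseteq> N" using i M_eq xN by auto
    have "excess (lower_modular_ext M N r) {x} {i} = 0"
      using excess_ext_mem_not_mem[of "{x}" "{i}" r] ix i
      by (simp add: lower_std_empty lower_std_singleton)
    then have "excess u {x} {i} = 0" using tight_transfer[OF sub] ix by blast
    then show ?thesis using ix by (simp add: excess_def insert_commute)
  qed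
  define c where "c = u {x} - u {}"
  have eq: "lower_modular_ext M N w S = u S + c * of_bool (x \<notin> S)" if S: "S \<subseteq> N" for S
  proof (cases "x \<in> S")
    case True
    then have "S - {x} \<subseteq> M" "insert x (S - {x}) = S" using S M_eq by auto
    then show ?thesis using True S by (simp add: lower_modular_ext_mem w_def)
  next
    case False
    then have SM: "S \<subseteq> M" using S M_eq by auto
    \<comment> \<open>Subtracting the standardization cancels \<open>w S\<close>, leaving only the
      modular part of \<open>w\<close>.\<close>
    have "lower_modular_ext M N w S = w {} - (\<Sum>i\<in>S. w {} - w {i})"
      using SM S False by (simp add: lower_modular_ext_not_mem lower_std_def)
    also have "\<dots> = u {x} - (\<Sum>i\<in>S. u {} - u {i})"
    proof -
      have "(\<Sum>i\<in>S. w {} - w {i}) = (\<Sum>i\<in>S. u {} - u {i})"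
        using SM pair by (intro sum.cong) (auto simp: w_def)
      then show ?thesis by (simp add: w_def)
    qed
    also have "\<dots> = u S + c"
      using modular_expansion[OF finite_subset[OF SM finite_M] SM modM] by (simp add: c_def)
    finally show ?thesis using False by simp
  qed
  have "excess (lower_modular_ext M N w) A B = excess u A B" if AB: "A \<subseteq> N" "B \<subseteq> N" for A B
  proof -
    have "excess (lower_modular_ext M N w) A B = excess (\<lambda>S. u S + c * of_bool (x \<notin> S)) A B"
      using eq AB by (rule excess_cong)
    \<comment> \<open>The indicator of \<open>x \<notin> S\<close> is modular, so its multiple by
      \<open>c\<close> contributes no excess.\<close>
    then show ?thesis by (simp add: excess_def)
  qed
  then show ?thesis by (auto simp: tight_def)
qed

section \<open>Extremality of the extension\<close>

text \<open>Both sides are read through \<open>is_extreme_iff\<close>. A competitor on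
  \<open>N\<close> is replaced by its link, whose extension has the same tight pairs; a competitor
  on \<open>M\<close> is replaced by its extension.\<close>

lemma extreme_ext_iff:
  assumes r: "r \<in> set_functions M"
  shows "is_extreme M r \<longleftrightarrow> is_extreme N (lower_modular_ext M N r)"
proof (cases "r \<in> supermodular_cone M")
  case False
  then show ?thesis using supermodular_ext_iff[OF r] by (simp add: is_extreme_def)
next
  case rs: True
  let ?T = "lower_modular_ext M N"
  have ms: "?T r \<in> supermodular_cone N" using rs supermodular_ext_iff[OF r] by simp
  have "(\<forall>u\<in>supermodular_cone M. tight M r \<subseteq> tight M u \<longrightarrow>
          tight M u = Pow M \<times> Pow M \<or> tight M u = tight M r) \<longleftrightarrow>
        (\<forall>u\<in>supermodular_cone N. tight N (?T r) \<subseteq> tight N u \<longrightarrow>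
          tight N u = Pow N \<times> Pow N \<or> tight N u = tight N (?T r))" (is "?L \<longleftrightarrow> ?R")
  proof
    assume L: ?L
    show ?R
    proof (intro ballI impI)
      fix u assume u: "u \<in> supermodular_cone N" and sub: "tight N (?T r) \<subseteq> tight N u"
      define w where "w = (\<lambda>T\<in>Pow M. u (insert x T))"
      have tw: "tight N (?T w) = tight N u" using tight_eq_ext_link[OF sub] by (simp add: w_def)
      have ws: "w \<in> supermodular_cone M"
      proof (rule supermodular_coneI)
        show "w \<in> set_functions M" by (simp add: w_def set_functions_def)
        fix A B assume AB: "A \<subseteq> M" "B \<subseteq> M"
        have "excess w A B = excess (\<lambda>T. u (insert x T)) A B"
          by (rule excess_cong[OF _ AB]) (simp add: w_def)
        also have "\<dots> = excess u (insert x A) (insert x B)" by (simp add: excess_def)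
        finally show "0 \<le> excess w A B"
          using excess_nonneg[OF u, of "insert x A" "insert x B"] AB M_eq xN by auto
      qed
      have rw: "tight M r \<subseteq> tight M w" using tw sub by (intro tight_ext_antimono) simp
      with L ws have "tight M w = Pow M \<times> Pow M \<or> tight M w = tight M r" by auto
      then show "tight N u = Pow N \<times> Pow N \<or> tight N u = tight N (?T r)"
      proof
        assume "tight M w = Pow M \<times> Pow M"
        then show ?thesis using tight_ext_top_iff[OF ws] tw by simp
      next
        assume "tight M w = tight M r"
        then have "tight N (?T w) \<subseteq> tight N (?T r)" by (intro tight_ext_mono[OF ws]) simp
        then show ?thesis using tw sub by simp
      qed
    qed
  next
    assume R: ?R
    show ?L
    proof (intro ballI impI)
      fix u assume u: "u \<in> supermodular_cone M" and sub: "tight M r \<subseteq> tight M u"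
      have "?T u \<in> supermodular_cone N"
        using u supermodular_ext_iff by (simp add: supermodular_cone_def)
      then have "tight N (?T u) = Pow N \<times> Pow N \<or> tight N (?T u) = tight N (?T r)"
        using R tight_ext_mono[OF rs sub] by auto
      then show "tight M u = Pow M \<times> Pow M \<or> tight M u = tight M r"
        using tight_ext_top_iff[OF u] tight_ext_antimono[of u r] sub by auto
    qed
  qed
  then show ?thesis
    using is_extreme_iff[OF finite_M, of r] is_extreme_iff[OF fin, of "?T r"] rs ms
      tight_ext_top_iff[OF rs] by simp
qed

section \<open>The induced independency model\<close>

lemma cond_indep_eq_excess:
  assumes "(a, b, C) \<in> triplets N"
  shows "cond_indep f a b C \<longleftrightarrow> excess f (insert a C) (insert b C) = 0"
proof -
  have "insert a C \<union> insert b C = {a} \<union> {b} \<union> C" "insert a C \<inter> insert b C = C"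
    using assms by (auto simp: triplets_def)
  then show ?thesis by (simp add: cond_indep_def excess_def algebra_simps)
qed

text \<open>The three alternatives are the three excess formulas at the sets
  \<open>insert a C\<close> and \<open>insert b C\<close>, according to whether neither, exactly one
  or both contain \<open>x\<close>.\<close>

lemma indep_model_ext_iff:
  assumes t: "(a, b, C) \<in> triplets N"
  shows "(a, b, C) \<in> indep_model N (lower_modular_ext M N r) \<longleftrightarrow>
    x \<notin> {a} \<union> {b} \<union> C \<or>
    (x \<in> {a, b} \<and> lower_std M r (({a} \<union> {b} \<union> C) - {x}) = lower_std M r C) \<or>
    (x \<in> C \<and> cond_indep r a b (C - {x}))"
proof -
  have ab: "a \<in> N" "b \<in> N" "a \<noteq> b" "C \<subseteq> N" "a \<notin> C" "b \<notin> C"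
    using t by (auto simp: triplets_def)
  have sub: "insert a C \<subseteq> N" "insert b C \<subseteq> N" using ab by auto
  have m: "(a, b, C) \<in> indep_model N (lower_modular_ext M N r) \<longleftrightarrow>
      excess (lower_modular_ext M N r) (insert a C) (insert b C) = 0"
    using t cond_indep_eq_excess[OF t] by (simp add: indep_model_def)
  consider "x \<notin> {a} \<union> {b} \<union> C" | "x = a" | "x = b" | "x \<in> C" by auto
  then show ?thesis
  proof cases
    case 1
    then have "insert a C \<subseteq> M" "insert b C \<subseteq> M" using sub M_eq by auto
    then show ?thesis using 1 m excess_ext_not_mem_not_mem by simp
  next
    case 2
    have "insert a C - {x} = C" "C \<union> insert b C = {a} \<union> {b} \<union> C - {x}" "insert b C \<subseteq> M"
      using 2 ab sub M_eq by auto
    then have "excess (lower_modular_ext M N r) (insert a C) (insert b C) =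
        lower_std M r ({a} \<union> {b} \<union> C - {x}) - lower_std M r C"
      using 2 excess_ext_mem_not_mem[OF sub(1), of "insert b C" r] by (simp only: insertI1)
    moreover have "x \<notin> C" "x \<in> {a, b}" using 2 ab by auto
    ultimately show ?thesis using m by auto
  next
    case 3
    have "insert b C - {x} = C" "C \<union> insert a C = {a} \<union> {b} \<union> C - {x}" "insert a C \<subseteq> M"
      using 3 ab sub M_eq by auto
    then have "excess (lower_modular_ext M N r) (insert a C) (insert b C) =
        lower_std M r ({a} \<union> {b} \<union> C - {x}) - lower_std M r C"
      using 3 excess_ext_mem_not_mem[OF sub(2), of "insert a C" r]
      by (simp only: insertI1 excess_commute)
    moreover have "x \<notin> C" "x \<in> {a, b}" using 3 ab by auto
    ultimately show ?thesis using m by auto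
  next
    case 4
    have "insert a C - {x} = insert a (C - {x})" "insert b C - {x} = insert b (C - {x})"
      using 4 ab by auto
    \<comment> \<open>The identity in \<open>cond_indep_eq_excess\<close> holds for an arbitrary
      function, so it applies to \<open>r\<close> with this triplet of \<open>N\<close>.\<close>
    moreover have "(a, b, C - {x}) \<in> triplets N" using t by (auto simp: triplets_def)
    ultimately show ?thesis
      using 4 m excess_ext_mem_mem[OF sub, of r] cond_indep_eq_excess ab by auto
  qed
qed

end

theorem mainTheorem7:
  fixes N M :: "'a set" and x :: 'a and r m :: "'a set \<Rightarrow> real"
  assumes "finite N" and "card N \<ge> 2" and "x \<in> N" and "M = N - {x}"
    and "r \<in> set_functions M" and "m = lower_modular_ext M N r"
  shows "(m \<in> supermodular_cone N \<longleftrightarrow> r \<in> supermodular_cone M) \<and>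
    (m \<in> supermodular_cone N \<longrightarrow>
       (\<forall>a b C. (a, b, C) \<in> triplets N \<longrightarrow>
          ((a, b, C) \<in> indep_model N m \<longleftrightarrow>
             x \<notin> {a} \<union> {b} \<union> C \<or>
             (x \<in> {a, b} \<and> lower_std M r (({a} \<union> {b} \<union> C) - {x}) = lower_std M r C) \<or>
             (x \<in> C \<and> cond_indep r a b (C - {x}))))) \<and>
    (is_extreme M r \<longleftrightarrow> is_extreme N m)"
  unfolding assms(6)
  using supermodular_ext_iff[OF assms(1,3,4,5)] indep_model_ext_iff[OF assms(1,3,4)]
    extreme_ext_iff[OF assms(1,3,4,5)]
  by blast

end
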